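(* Let $G$ be a finite simple graph with adjacency matrix $A$, let $x$ be a vertex of $G$, and let $X$ be the set of neighbours of $x$ in $G$ (assume $0<|X|<|V(G)|$). Let $G_X$ be the graph obtained from $G$ by Seidel switching with respect to $X$. Then $x$ is an isolated vertex of $G_X$. Moreover, $\mathrm{2\text{-}rank}(G_X)=\mathrm{2\text{-}rank}(G)-2$ if $\mathbf{1}\in\mathrm{Col}_2(G)$, and $\mathrm{2\text{-}rank}(G_X)=\mathrm{2\text{-}rank}(G)$ otherwise.
   Context: All graphs are finite, simple and undirected. The 2-rank of a graph $G$, written $\mathrm{2\text{-}rank}(G)$, is the rank over $\mathbb{F}_2$ of its adjacency matrix. $\mathrm{Col}_2(G)$ denotes the column space over $\mathbb{F}_2$ of the adjacency matrix of $G$, and $\mathbf{1}$ is the all-ones vector. For a vertex subset $X$ of a graph $G=(V,E)$, Seidel switching with respect to $X$ produces the graph on $V$ in which all edges between $X$ and $V\setminus X$ are removed and every non-edge between $X$ and $V\setminus X$ is made an edge, while edges with both ends in $X$ or both ends in $V\setminus X$ are unchanged. *)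

theory Defs
  imports "HOL-Analysis.Analysis" "HOL-Library.Z2"
begin

text \<open>A finite simple graph on the finite vertex type 'n: a symmetric, irreflexive
  adjacency relation E.\<close>
definition simple_graph :: "('n::finite \<Rightarrow> 'n \<Rightarrow> bool) \<Rightarrow> bool" where
  "simple_graph E \<longleftrightarrow> (\<forall>u v. E u v \<longleftrightarrow> E v u) \<and> (\<forall>u. \<not> E u u)"

text \<open>Adjacency matrix over F_2 (the field bit).\<close>
definition adj_matrix2 :: "('n::finite \<Rightarrow> 'n \<Rightarrow> bool) \<Rightarrow> bit ^'n ^'n" where
  "adj_matrix2 E = (\<chi> i j. if E i j then 1 else 0)"

definition rank2 :: "('n::finite \<Rightarrow> 'n \<Rightarrow> bool) \<Rightarrow> nat" where
  "rank2 E = rank (adj_matrix2 E)"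

text \<open>Column space over F_2 of the adjacency matrix.\<close>
definition Col2 :: "('n::finite \<Rightarrow> 'n \<Rightarrow> bool) \<Rightarrow> (bit ^'n) set" where
  "Col2 E = vec.span (columns (adj_matrix2 E))"

definition neighbours :: "('n \<Rightarrow> 'n \<Rightarrow> bool) \<Rightarrow> 'n \<Rightarrow> 'n set" where
  "neighbours E x = {y. E x y}"

text \<open>Seidel switching with respect to X: edges/non-edges between X and its complement
  are complemented, all other adjacencies kept.\<close>
definition seidel_switch :: "('n \<Rightarrow> 'n \<Rightarrow> bool) \<Rightarrow> 'n set \<Rightarrow> 'n \<Rightarrow> 'n \<Rightarrow> bool" where
  "seidel_switch E X u v = (if (u \<in> X) = (v \<in> X) then E u v else \<not> E u v)"

definition isolated :: "('n \<Rightarrow> 'n \<Rightarrow> bool) \<Rightarrow> 'n \<Rightarrow> bool" where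
  "isolated E x \<longleftrightarrow> (\<forall>y. \<not> E x y)"

end

(*
  Let d be the column of the adjacency matrix A indexed by x, i.e. the indicator vector of the
  neighbourhood of x. Over F_2, switching with respect to that neighbourhood turns A into
  A' = A + d 1^T + 1 d^T, whose row x vanishes. Hence Col A' + <1, d> = Col A + <1, d>, and 1 lies
  outside Col A' + <d> because every vector there has x-coordinate 0.
  If A w = 1, then w^T A w = 0 since A is alternating, so A' w = 0; thus w is orthogonal to
  Col A' while w.d = 1, and Col A = Col A' (+) <1, d> has dimension rank A' + 2.
  If 1 is not in Col A, the Fredholm alternative gives v in ker A with 1.v = 1; then A' v = d, so
  Col A (+) <1> = Col A' (+) <1> and the ranks agree.
*)

theory Submission
  imports Defs
begin

(* Z2 rewrites + and * on bit to xor and and by default; keep them in ring form. *)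
declare add_bit_eq_xor [simp del] mult_bit_eq_and [simp del]

lemma bit_add_self [simp]: "(b::bit) + b = 0"
  by (cases b) simp_all

lemma vec_bit_add_self [simp]: "(v::bit^'n) + v = 0"
  by (simp add: vec_eq_iff)

lemma vec_bit_eq_add_iff: "u = v + w \<longleftrightarrow> v = u + (w::bit^'n)"
  by (auto simp: add.assoc)

abbreviation ones :: "'a::one^'n" where
  "ones \<equiv> \<chi> i. 1"

definition dot :: "'a::comm_semiring_0^'n \<Rightarrow> 'a^'n \<Rightarrow> 'a" where
  "dot a b = (\<Sum>j\<in>UNIV. a$j * b$j)"

lemma dot_commute: "dot a b = dot b a"
  by (simp add: dot_def mult.commute)

lemma dot_add_right: "dot a (b + c) = dot a b + dot a c"
  by (simp add: dot_def sum.distrib distrib_left)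

lemma dot_scale_right: "dot a (c *s b) = c * dot a b"
  by (simp add: dot_def sum_distrib_left mult_ac)

lemma dot_zero_left [simp]: "dot 0 b = 0"
  by (simp add: dot_def)

lemma dot_zero_right [simp]: "dot a 0 = 0"
  by (simp add: dot_def)

lemma dot_axis_left [simp]: "dot (axis i 1) v = (v $ i :: 'a::comm_semiring_1)"
proof -
  have "dot (axis i 1) v = (\<Sum>j\<in>UNIV. if j = i then v $ j else 0)"
    unfolding dot_def by (intro sum.cong) (auto simp: axis_def)
  then show ?thesis
    by simp
qed

lemma dot_matrix_vector_mult: "dot a (M *v b) = dot (transpose M *v a) b"
proof -
  have "dot a (M *v b) = (\<Sum>j\<in>UNIV. \<Sum>k\<in>UNIV. a$j * M$j$k * b$k)"
    by (simp add: dot_def matrix_vector_mult_def sum_distrib_left mult.assoc)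
  also have "\<dots> = (\<Sum>k\<in>UNIV. \<Sum>j\<in>UNIV. a$j * M$j$k * b$k)"
    by (rule sum.swap)
  also have "\<dots> = (\<Sum>k\<in>UNIV. (\<Sum>j\<in>UNIV. a$j * M$j$k) * b$k)"
    by (simp add: sum_distrib_right)
  also have "\<dots> = dot (transpose M *v a) b"
    by (simp add: dot_def matrix_vector_mult_def transpose_def mult.commute)
  finally show ?thesis .
qed

lemma subspace_dot_eq_0: "vec.subspace {v. dot w v = 0}"
  by (simp add: vec.subspace_def dot_add_right dot_scale_right)

lemma subspace_component_eq_0: "vec.subspace {v. v $ i = 0}"
  by (simp add: vec.subspace_def)

lemma matrix_vector_mult_axis: "M *v axis i 1 = column i (M::'a::semiring_1^'n^'m)"
  by (simp add: column_def matrix_vector_mult_def axis_def vec_eq_iff if_distrib sum.If_cases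
      cong: if_cong)

lemma span_columns_eq_range: "vec.span (columns (M::'a::field^'n^'m)) = range ((*v) M)"
proof -
  have "columns M = (*v) M ` cart_basis"
    by (force simp: columns_def cart_basis_def image_iff matrix_vector_mult_axis)
  then show ?thesis
    by (simp add: vec.span_image)
qed

lemma subspace_range_matrix_vector_mult: "vec.subspace (range ((*v) (M::'a::field^'n^'m)))"
  by (metis span_columns_eq_range vec.subspace_span)

lemma span_range_matrix_vector_mult: "vec.span (range ((*v) (M::'a::field^'n^'m))) = range ((*v) M)"
  by (metis span_columns_eq_range vec.span_span)

lemma rank_eq_dim_range_if_symmetric:
  fixes A :: "'a::field^'n^'n"
  assumes "transpose A = A"
  shows "rank A = vec.dim (range ((*v) A))"
proof -
  have "rows A = columns A"
    by (metis assms rows_transpose)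
  then show ?thesis
    by (metis row_rank_def_gen span_columns_eq_range vec.dim_span)
qed

lemma transpose_eq_self_iff: "transpose M = M \<longleftrightarrow> (\<forall>i j. M$i$j = M$j$i)"
  by (auto simp: transpose_def vec_eq_iff)

lemma matrix_vector_mult_component_dot: "(M *v v) $ i = dot (M $ i) v"
  by (simp add: matrix_vector_mult_def dot_def)

lemma linear_functional_dot:
  fixes g :: "'a::field^'n \<Rightarrow> 'a"
  assumes "Vector_Spaces.linear (*s) (*) g"
  shows "g z = dot z (\<chi> j. g (axis j 1))"
proof -
  interpret g: Vector_Spaces.linear "(*s)" "(*)" g by (fact assms)
  have "g z = g (\<Sum>j\<in>UNIV. z $ j *s axis j 1)"
    by (simp add: basis_expansion)
  also have "\<dots> = dot z (\<chi> j. g (axis j 1))"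
    by (simp add: g.sum g.scale dot_def)
  finally show ?thesis .
qed

(* Fredholm alternative: a functional vanishing on the column space but not at b is the dot
   product with some vector, which lies in the kernel by symmetry. *)
lemma kernel_witness_if_not_in_range:
  fixes M :: "'a::field^'n^'n"
  assumes symmetric: "transpose M = M" and b: "b \<notin> range ((*v) M)"
  obtains v where "M *v v = 0" and "dot b v = 1"
proof -
  interpret vector_space_pair "(*s) :: 'a \<Rightarrow> 'a^'n \<Rightarrow> 'a^'n" "(*) :: 'a \<Rightarrow> 'a \<Rightarrow> 'a" ..
  obtain B where B: "B \<subseteq> range ((*v) M)" "vec.independent B" "range ((*v) M) \<subseteq> vec.span B"
    by (meson vec.basis_exists)
  have "vec.span B = range ((*v) M)"
    using vec.span_minimal[OF B(1) subspace_range_matrix_vector_mult] B(3) by (rule antisym)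
  then have "b \<notin> vec.span B"
    using b by simp
  then have independent: "vec.independent (insert b B)"
    using B(2) by (simp add: vec.independent_insert)
  then obtain g where g: "Vector_Spaces.linear (*s) (*) g"
    and g_basis: "\<forall>z\<in>insert b B. g z = (if z = b then 1 else 0)"
    using linear_independent_extend[OF independent, of "\<lambda>z. if z = b then 1 else 0"] by blast
  interpret g: Vector_Spaces.linear "(*s)" "(*)" g by (fact g)
  have g_B: "g z = 0" if "z \<in> B" for z
    using g_basis that \<open>b \<notin> vec.span B\<close> vec.span_base by fastforce
  have g_range: "g (M *v u) = 0" for u
    using g.eq_0_on_span[OF g_B] B(3) by (simp add: subset_iff)
  define v where "v = (\<chi> j. g (axis j 1))"
  have g_dot: "g z = dot z v" for z
    unfolding v_def by (rule linear_functional_dot[OF g])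
  have "M *v v = 0"
    unfolding vec_eq_iff
  proof
    fix i
    have "M $ i = M *v axis i 1"
      using symmetric unfolding transpose_eq_self_iff
      by (simp add: matrix_vector_mult_axis column_def vec_eq_iff)
    then show "(M *v v) $ i = 0 $ i"
      using g_range g_dot[of "M $ i"] by (simp add: matrix_vector_mult_component_dot)
  qed
  moreover have "dot b v = 1"
    using g_basis g_dot[of b] by simp
  ultimately show ?thesis
    using that by blast
qed

lemma dot_matrix_vector_mult_self_eq_0:
  fixes M :: "bit^'n^'n"
  assumes symmetric: "transpose M = M" and alternating: "\<And>i. M$i$i = 0"
  shows "dot (M *v w) w = 0"
proof -
  define f where "f i j = M$i$j * w$i * w$j" for i j
  have f_sym: "f i j = f j i" for i j
    using symmetric by (simp add: transpose_eq_self_iff f_def mult_ac)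
  have "(\<Sum>i\<in>S. \<Sum>j\<in>S. f i j) = 0" if "finite S" for S :: "'n set"
    using that
  proof (induction S rule: finite_induct)
    case (insert a S)
    have "(\<Sum>i\<in>insert a S. \<Sum>j\<in>insert a S. f i j)
       = (\<Sum>i\<in>S. \<Sum>j\<in>S. f i j) + ((\<Sum>i\<in>S. f i a) + (\<Sum>j\<in>S. f a j)) + f a a"
      using insert by (simp add: sum.distrib algebra_simps)
    also have "(\<Sum>i\<in>S. f i a) = (\<Sum>j\<in>S. f a j)"
      using f_sym by simp
    finally show ?case
      using insert alternating by (simp add: f_def)
  qed simp
  moreover have "dot (M *v w) w = (\<Sum>i\<in>UNIV. \<Sum>j\<in>UNIV. f i j)"
    by (simp add: dot_def f_def matrix_vector_mult_def sum_distrib_right sum_distrib_left mult_ac)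
  ultimately show ?thesis
    by simp
qed

(* Switching at the neighbourhood of x flips entry (i, j) iff exactly one of i, j is adjacent
   to x, i.e. adds M$i$x + M$j$x over F_2. *)
definition neighbourhood_switch :: "bit^'n^'n \<Rightarrow> 'n \<Rightarrow> bit^'n^'n" where
  "neighbourhood_switch M x = (\<chi> i j. M$i$j + M$i$x + M$j$x)"

lemma neighbourhood_switch_mult:
  "neighbourhood_switch M x *v v
     = M *v v + dot ones v *s column x M + dot (column x M) v *s ones"
  unfolding vec_eq_iff
proof
  fix i
  have "(neighbourhood_switch M x *v v) $ i
      = (\<Sum>j\<in>UNIV. M$i$j * v$j + M$i$x * v$j + M$j$x * v$j)"
    by (simp add: neighbourhood_switch_def matrix_vector_mult_def distrib_right)
  also have "\<dots> = (M *v v + dot ones v *s column x M + dot (column x M) v *s ones) $ i"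
    by (simp add: sum.distrib matrix_vector_mult_def dot_def column_def sum_distrib_left
        sum_distrib_right mult.commute)
  finally show "(neighbourhood_switch M x *v v) $ i
      = (M *v v + dot ones v *s column x M + dot (column x M) v *s ones) $ i" .
qed

lemma transpose_neighbourhood_switch:
  "transpose M = M \<Longrightarrow> transpose (neighbourhood_switch M x) = neighbourhood_switch M x"
  by (simp add: transpose_eq_self_iff neighbourhood_switch_def add_ac)

lemma neighbourhood_switch_row_eq_0:
  assumes "transpose M = M" and "M$x$x = 0"
  shows "neighbourhood_switch M x $ x = 0"
  unfolding vec_eq_iff
proof
  fix j
  have "M$x$j = M$j$x"
    using assms(1) by (simp add: transpose_eq_self_iff)
  then show "neighbourhood_switch M x $ x $ j = 0 $ j"
    using assms(2) by (simp add: neighbourhood_switch_def)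
qed

context
  fixes M :: "bit^'n^'n" and x :: 'n
  assumes symmetric: "transpose M = M" and alternating: "\<And>i. M$i$i = 0"
begin

lemma mult_eq_neighbourhood_switch_mult:
  "M *v v = neighbourhood_switch M x *v v + (dot ones v *s column x M + dot (column x M) v *s ones)"
  using neighbourhood_switch_mult[of M x v] by (simp add: vec_bit_eq_add_iff add.assoc)

lemma ones_not_in_span_neighbourhood_switch_range:
  "ones \<notin> vec.span (insert (column x M) (range ((*v) (neighbourhood_switch M x))))"
proof -
  have "(neighbourhood_switch M x *v v) $ x = 0" for v
    using neighbourhood_switch_row_eq_0[OF symmetric alternating]
    by (simp add: matrix_vector_mult_component_dot dot_def)
  moreover have "column x M $ x = 0"
    by (simp add: column_def alternating)
  ultimately have "vec.span (insert (column x M) (range ((*v) (neighbourhood_switch M x))))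
      \<subseteq> {v. v $ x = 0}"
    by (intro vec.span_minimal subspace_component_eq_0) auto
  then show ?thesis
    by auto
qed

lemma range_subset_span_neighbourhood_switch_range:
  "range ((*v) M)
     \<subseteq> vec.span (insert ones (insert (column x M) (range ((*v) (neighbourhood_switch M x)))))"
proof
  fix z assume "z \<in> range ((*v) M)"
  then obtain v where z: "z = M *v v" by blast
  show "z \<in> vec.span (insert ones (insert (column x M) (range ((*v) (neighbourhood_switch M x)))))"
    unfolding z mult_eq_neighbourhood_switch_mult
    by (intro vec.span_add vec.span_scale vec.span_base) auto
qed

lemma neighbourhood_switch_kernel_if_mult_eq_ones:
  assumes w: "M *v w = ones"
  shows "neighbourhood_switch M x *v w = 0" and "dot w (column x M) = 1"
proof -
  have "dot (column x M) w = 1"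
    using dot_matrix_vector_mult[of "axis x 1" M w] symmetric w
    by (simp add: matrix_vector_mult_axis)
  moreover have "dot ones w = 0"
    using dot_matrix_vector_mult_self_eq_0[OF symmetric alternating, of w] w by simp
  ultimately show "neighbourhood_switch M x *v w = 0" and "dot w (column x M) = 1"
    using w by (simp_all add: neighbourhood_switch_mult dot_commute)
qed

lemma dim_range_neighbourhood_switch_if_ones_in_range:
  assumes "ones \<in> range ((*v) M)"
  shows "vec.dim (range ((*v) (neighbourhood_switch M x))) + 2 = vec.dim (range ((*v) M))"
proof -
  let ?M' = "neighbourhood_switch M x" and ?d = "column x M"
  let ?C = "range ((*v) M)" and ?C' = "range ((*v) ?M')"
  obtain w where w: "M *v w = ones"
    using assms by force
  note M'_w = neighbourhood_switch_kernel_if_mult_eq_ones[OF w]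
  have "?C' \<subseteq> {z. dot w z = 0}"
    using dot_matrix_vector_mult[of w ?M'] transpose_neighbourhood_switch[OF symmetric] M'_w(1)
    by auto
  then have "vec.span ?C' \<subseteq> {z. dot w z = 0}"
    by (intro vec.span_minimal subspace_dot_eq_0)
  then have "?d \<notin> vec.span ?C'"
    using M'_w(2) by auto
  then have dim_insert: "vec.dim (insert ones (insert ?d ?C')) = vec.dim ?C' + 2"
    using ones_not_in_span_neighbourhood_switch_range by (simp add: vec.dim_insert)
  have "?M' *v v = M *v (v + dot ones v *s axis x 1 + dot ?d v *s w)" for v
    using w by (simp add: neighbourhood_switch_mult matrix_vector_right_distrib vec.scale
        matrix_vector_mult_axis)
  then have "insert ones (insert ?d ?C') \<subseteq> ?C"
    using range_eqI[of ones "(*v) M" w] w by (auto simp flip: matrix_vector_mult_axis)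
  then have "vec.span (insert ones (insert ?d ?C')) = ?C"
    using vec.span_minimal[OF _ subspace_range_matrix_vector_mult]
      range_subset_span_neighbourhood_switch_range by blast
  then show ?thesis
    using dim_insert by (metis vec.dim_span)
qed

lemma column_in_neighbourhood_switch_range_if_ones_not_in_range:
  assumes "ones \<notin> range ((*v) M)"
  shows "column x M \<in> range ((*v) (neighbourhood_switch M x))"
proof -
  obtain v where v: "M *v v = 0" "dot ones v = 1"
    using kernel_witness_if_not_in_range[OF symmetric assms] .
  have "dot (column x M) v = 0"
    using dot_matrix_vector_mult[of "axis x 1" M v] symmetric v
    by (simp add: matrix_vector_mult_axis)
  then have "neighbourhood_switch M x *v v = column x M"
    using v by (simp add: neighbourhood_switch_mult)
  then show ?thesis
    by (metis rangeI)
qed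

lemma dim_range_neighbourhood_switch_if_ones_not_in_range:
  assumes "ones \<notin> range ((*v) M)"
  shows "vec.dim (range ((*v) (neighbourhood_switch M x))) = vec.dim (range ((*v) M))"
proof -
  let ?M' = "neighbourhood_switch M x" and ?d = "column x M"
  let ?C = "range ((*v) M)" and ?C' = "range ((*v) ?M')"
  have d_C': "?d \<in> ?C'"
    using column_in_neighbourhood_switch_range_if_ones_not_in_range[OF assms] .
  have "vec.span (insert ones ?C) = vec.span (insert ones ?C')"
    unfolding vec.span_eq
  proof
    have "?C \<subseteq> vec.span (insert ones ?C')"
      using range_subset_span_neighbourhood_switch_range d_C' by (simp add: insert_absorb)
    then show "insert ones ?C \<subseteq> vec.span (insert ones ?C')"
      by (simp add: vec.span_base)
    have "?C' \<subseteq> vec.span (insert ones ?C)"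
    proof
      fix z assume "z \<in> ?C'"
      then obtain u where z: "z = ?M' *v u" by blast
      show "z \<in> vec.span (insert ones ?C)"
        unfolding z neighbourhood_switch_mult
        by (intro vec.span_add vec.span_scale vec.span_base) (auto simp flip: matrix_vector_mult_axis)
    qed
    then show "insert ones ?C' \<subseteq> vec.span (insert ones ?C)"
      by (simp add: vec.span_base)
  qed
  moreover have "ones \<notin> vec.span ?C"
    using assms by (simp add: span_range_matrix_vector_mult)
  moreover have "ones \<notin> vec.span ?C'"
    using ones_not_in_span_neighbourhood_switch_range vec.span_mono[of ?C' "insert ?d ?C'"] by blast
  ultimately show ?thesis
    by (metis vec.dim_span vec.dim_insert add_right_cancel)
qed

end

lemma transpose_adj_matrix2: "simple_graph E \<Longrightarrow> transpose (adj_matrix2 E) = adj_matrix2 E"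
  by (auto simp: simple_graph_def transpose_eq_self_iff adj_matrix2_def)

lemma adj_matrix2_diagonal: "simple_graph E \<Longrightarrow> adj_matrix2 E $ i $ i = 0"
  by (simp add: simple_graph_def adj_matrix2_def)

lemma adj_matrix2_seidel_switch_neighbours:
  assumes "simple_graph E"
  shows "adj_matrix2 (seidel_switch E (neighbours E x)) = neighbourhood_switch (adj_matrix2 E) x"
proof -
  have "E i x = E x i" for i
    using assms by (simp add: simple_graph_def)
  then show ?thesis
    unfolding vec_eq_iff
    by (auto simp: adj_matrix2_def neighbourhood_switch_def seidel_switch_def neighbours_def)
qed

lemma isolated_seidel_switch_neighbours:
  "simple_graph E \<Longrightarrow> isolated (seidel_switch E (neighbours E x)) x"
  by (simp add: simple_graph_def isolated_def seidel_switch_def neighbours_def)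

theorem lemma2p1:
  fixes E :: "'n::finite \<Rightarrow> 'n \<Rightarrow> bool" and x :: 'n
  assumes "simple_graph E"
    and "0 < card (neighbours E x)"
    and "card (neighbours E x) < CARD('n)"
  shows "isolated (seidel_switch E (neighbours E x)) x
    \<and> (if ((\<chi> i. 1) :: bit ^'n) \<in> Col2 E
       then rank2 (seidel_switch E (neighbours E x)) = rank2 E - 2
       else rank2 (seidel_switch E (neighbours E x)) = rank2 E)"
proof -
  let ?A = "adj_matrix2 E"
  have symmetric: "transpose ?A = ?A" and alternating: "\<And>i. ?A $ i $ i = 0"
    using assms(1) by (simp_all add: transpose_adj_matrix2 adj_matrix2_diagonal)
  have rank_A: "rank2 E = vec.dim (range ((*v) ?A))"
    unfolding rank2_def by (rule rank_eq_dim_range_if_symmetric[OF symmetric])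
  have rank_switch: "rank2 (seidel_switch E (neighbours E x))
      = vec.dim (range ((*v) (neighbourhood_switch ?A x)))"
    unfolding rank2_def adj_matrix2_seidel_switch_neighbours[OF assms(1)]
    by (rule rank_eq_dim_range_if_symmetric[OF transpose_neighbourhood_switch[OF symmetric]])
  show ?thesis
    using isolated_seidel_switch_neighbours[OF assms(1)]
      dim_range_neighbourhood_switch_if_ones_in_range[OF symmetric alternating, of x]
      dim_range_neighbourhood_switch_if_ones_not_in_range[OF symmetric alternating, of x]
    by (auto simp: rank_A rank_switch Col2_def span_columns_eq_range)
qed

end
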